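(* Let $\Phi(z)=1+B_1z+B_2z^2+B_3z^3+\cdots$ be analytic and univalent in $\mathbb{D}=\{z\in\mathbb{C}:|z|<1\}$, such that $\Phi(\mathbb{D})$ is symmetric with respect to the real axis and starlike with respect to $\Phi(0)=1$, and $\Phi'(0)=B_1>0$. For $f(z)=z+\sum_{n\ge2}a_nz^n$ in the Ma--Minda convex class $\mathcal{C}(\Phi)$, let $f^{-1}(z)=z+\sum_{n\ge2}A_nz^n$ be the Taylor expansion at $0$ of its inverse. If $B_2=\dfrac{B_1^2}{2}$, then the sharp lower bounds on $|a_3|-|a_2|$ and on $|A_3|-|A_2|$ over $\mathcal{C}(\Phi)$ are the same, i.e. $$\min_{f\in\mathcal{C}(\Phi)}\left(|a_3|-|a_2|\right)=\min_{f\in\mathcal{C}(\Phi)}\left(|A_3|-|A_2|\right).$$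
   Context: $\mathcal{A}$ denotes the class of functions $f$ analytic in $\mathbb{D}$ with $f(0)=0$, $f'(0)=1$, i.e. $f(z)=z+\sum_{n\ge2}a_nz^n$. For analytic $g,h$ on $\mathbb{D}$, $g$ is subordinate to $h$, written $g\prec h$, if there is an analytic $\omega:\mathbb{D}\to\mathbb{D}$ with $\omega(0)=0$ such that $g(z)=h(\omega(z))$ for all $z\in\mathbb{D}$. For $\Phi$ as in the statement, the Ma--Minda convex class $\mathcal{C}(\Phi)$ is the set of all $f\in\mathcal{A}$ such that $1+\dfrac{zf''(z)}{f'(z)}\prec\Phi(z)$ in $\mathbb{D}$. The inverse $f^{-1}$ is the inverse of $f$ near the origin, satisfying $f(f^{-1}(z))=z$ near $0$; its initial coefficients are $A_2=-a_2$ and $A_3=2a_2^2-a_3$. *)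

theory Defs
  imports "HOL-Complex_Analysis.Complex_Analysis"
begin

abbreviation unit_disc :: "complex set" ("\<bbbD>") where
  "\<bbbD> \<equiv> ball 0 1"

abbreviation taylor_coeff :: "(complex \<Rightarrow> complex) \<Rightarrow> nat \<Rightarrow> complex" where
  "taylor_coeff f n \<equiv> fps_nth (fps_expansion f 0) n"

text \<open>Functions are total on \<^typ>\<open>complex\<close>; only their values on \<open>\<bbbD>\<close> matter below.\<close>

definition class_A :: "(complex \<Rightarrow> complex) set" where
  "class_A = {f. f holomorphic_on \<bbbD> \<and> f 0 = 0 \<and> deriv f 0 = 1}"

definition subordinate :: "(complex \<Rightarrow> complex) \<Rightarrow> (complex \<Rightarrow> complex) \<Rightarrow> bool"
  (infix "\<prec>\<^sub>D" 50) where
  "g \<prec>\<^sub>D h \<longleftrightarrow> g holomorphic_on \<bbbD> \<and> h holomorphic_on \<bbbD> \<and>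
     (\<exists>\<omega>. \<omega> holomorphic_on \<bbbD> \<and> \<omega> ` \<bbbD> \<subseteq> \<bbbD> \<and> \<omega> 0 = 0 \<and> (\<forall>z\<in>\<bbbD>. g z = h (\<omega> z)))"

definition ma_minda_function :: "(complex \<Rightarrow> complex) \<Rightarrow> bool" where
  "ma_minda_function \<Phi> \<longleftrightarrow>
     \<Phi> holomorphic_on \<bbbD> \<and> inj_on \<Phi> \<bbbD> \<and> \<Phi> 0 = 1 \<and>
     cnj ` (\<Phi> ` \<bbbD>) = \<Phi> ` \<bbbD> \<and>
     (\<forall>w \<in> \<Phi> ` \<bbbD>. closed_segment 1 w \<subseteq> \<Phi> ` \<bbbD>) \<and>
     deriv \<Phi> 0 \<in> \<real> \<and> Re (deriv \<Phi> 0) > 0"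

text \<open>The condition \<open>f' \<noteq> 0\<close>, implicit in the analyticity of \<open>1 + z f''/f'\<close>, is spelled out because
  division by zero is total in HOL.\<close>

definition ma_minda_convex :: "(complex \<Rightarrow> complex) \<Rightarrow> (complex \<Rightarrow> complex) set" where
  "ma_minda_convex \<Phi> =
     {f \<in> class_A. (\<forall>z\<in>\<bbbD>. deriv f z \<noteq> 0) \<and>
        (\<lambda>z. 1 + z * deriv (deriv f) z / deriv f z) \<prec>\<^sub>D \<Phi>}"

definition is_inverse_near_0 :: "(complex \<Rightarrow> complex) \<Rightarrow> (complex \<Rightarrow> complex) \<Rightarrow> bool" where
  "is_inverse_near_0 f g \<longleftrightarrow>
     g analytic_on {0} \<and> g 0 = 0 \<and> (\<forall>\<^sub>F z in nhds 0. f (g z) = z)"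

text \<open>For \<open>f\<close> in \<^const>\<open>class_A\<close> such a \<open>g\<close> exists and its germ at \<open>0\<close> is unique, so the Taylor
  coefficients at \<open>0\<close> do not depend on the choice.\<close>

definition inverse_near_0 :: "(complex \<Rightarrow> complex) \<Rightarrow> complex \<Rightarrow> complex" where
  "inverse_near_0 f = (SOME g. is_inverse_near_0 f g)"

end

theory Submission
  imports Defs
begin

text \<open>
  Write \<open>1 + z f''/f' = \<Phi> \<circ> \<omega>\<close> with a Schwarz function \<open>\<omega>(z) = c z + d z\<^sup>2 + \<dots>\<close>. Comparing
  coefficients gives \<open>a\<^sub>2 = B\<^sub>1 c / 2\<close> and \<open>6 a\<^sub>3 = B\<^sub>1 d + (B\<^sub>2 + B\<^sub>1\<^sup>2) c\<^sup>2\<close>. Under \<open>B\<^sub>2 = B\<^sub>1\<^sup>2 / 2\<close> the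
  last equation becomes \<open>a\<^sub>3 = a\<^sub>2\<^sup>2 + B\<^sub>1 d / 6\<close>, so that
  \<open>A\<^sub>2 = - a\<^sub>2\<close> and \<open>A\<^sub>3 = 2 a\<^sub>2\<^sup>2 - a\<^sub>3 = a\<^sub>2\<^sup>2 - B\<^sub>1 d / 6\<close>.
  Up to the sign of \<open>A\<^sub>2\<close>, which the modulus does not see, passing to the inverse function therefore
  amounts to replacing \<open>d\<close> by \<open>-d\<close>.

  The pairs \<open>(c, d)\<close> that occur are exactly those with \<open>|c| \<le> 1\<close> and \<open>|d| \<le> 1 - |c|\<^sup>2\<close>: necessity is the
  Schwarz--Pick inequality at the origin (\<open>schwarz_function_coeffs\<close>), sufficiency is an explicit
  Moebius construction (\<open>schwarz_function_exists\<close>), and every Schwarz function comes from some \<open>f\<close> in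
  the class because the differential equation for \<open>f\<close> can be integrated on the disc
  (\<open>ma_minda_convex_exists\<close>). This set of pairs is invariant under \<open>d \<mapsto> -d\<close>, so both functionals have
  the same range over the class. The set is also compact and the functionals are continuous in
  \<open>(c, d)\<close>, so the common infimum is attained.
\<close>

section \<open>Coefficients of Schwarz functions\<close>

definition schwarz_function :: "(complex \<Rightarrow> complex) \<Rightarrow> bool" where
  "schwarz_function \<omega> \<longleftrightarrow> \<omega> holomorphic_on \<bbbD> \<and> \<omega> ` \<bbbD> \<subseteq> \<bbbD> \<and> \<omega> 0 = 0"

definition schwarz_coeffs :: "(complex \<times> complex) set" where
  "schwarz_coeffs = {(c, d). cmod c \<le> 1 \<and> cmod d \<le> 1 - (cmod c)\<^sup>2}"

lemma has_fps_expansion_on_disc: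
  assumes "f holomorphic_on \<bbbD>"
  shows "f has_fps_expansion fps_expansion f 0"
  by (rule analytic_at_imp_has_fps_expansion_0)
     (use assms in \<open>auto intro: holomorphic_on_imp_analytic_at\<close>)

lemma eventually_nhds_0_if_on_disc:
  assumes "\<And>z. z \<in> \<bbbD> \<Longrightarrow> P z"
  shows "eventually P (nhds (0::complex))"
  using assms eventually_nhds_in_open[of \<bbbD> 0] by (auto elim: eventually_mono)

lemma fps_expansion_unique_eventually:
  fixes f g :: "complex \<Rightarrow> complex"
  assumes "f has_fps_expansion F" "g has_fps_expansion G" "\<forall>\<^sub>F z in nhds 0. f z = g z"
  shows "F = G"
  using has_fps_expansion_cong[OF assms(3) refl, of F] assms(1,2)
  by (auto intro: fps_expansion_unique_complex)

lemma taylor_coeff_0: "taylor_coeff f 0 = f 0"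
  by (simp add: fps_expansion_def)

lemma taylor_coeff_1: "taylor_coeff f (Suc 0) = deriv f 0"
  by (simp add: fps_expansion_def)

lemma one_minus_cmod_square: "1 - cnj c * c = of_real (1 - (cmod c)\<^sup>2)"
  by (metis complex_norm_square mult.commute of_real_1 of_real_diff)

text \<open>Either \<open>|h|\<close> reaches 1 inside the disc and \<open>h\<close> is constant by the maximum principle, or the
  Moebius map sending \<open>h 0\<close> to \<open>0\<close> can be composed with \<open>h\<close>; its derivative at \<open>h 0\<close> is
  \<open>1 / (1 - |h 0|\<^sup>2)\<close>, and the Schwarz lemma bounds the derivative of the composition by 1.\<close>

lemma Schwarz_Pick_at_0:
  assumes hol: "h holomorphic_on \<bbbD>" and le: "\<And>z. z \<in> \<bbbD> \<Longrightarrow> cmod (h z) \<le> 1"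
  shows "cmod (deriv h 0) \<le> 1 - (cmod (h 0))\<^sup>2"
proof (cases "\<exists>\<gamma>\<in>\<bbbD>. cmod (h \<gamma>) = 1")
  case True
  then obtain \<gamma> where \<gamma>: "\<gamma> \<in> \<bbbD>" "cmod (h \<gamma>) = 1"
    by blast
  have "h constant_on \<bbbD>"
    by (rule maximum_modulus_principle[OF hol, of \<bbbD> \<gamma>]) (use \<gamma> le in auto)
  then obtain k where k: "\<And>z. z \<in> \<bbbD> \<Longrightarrow> h z = k"
    unfolding constant_on_def by blast
  have "deriv h 0 = deriv (\<lambda>_. k) 0"
    by (rule complex_derivative_transform_within_open[OF hol _ open_ball]) (use k in auto)
  moreover have "cmod (h 0) = 1"
    using k[of 0] k[OF \<gamma>(1)] \<gamma>(2) by simp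
  ultimately show ?thesis
    by simp
next
  case False
  with le have lt: "cmod (h z) < 1" if "z \<in> \<bbbD>" for z
    using that by (meson order_le_less)
  have lt0: "cmod (h 0) < 1"
    by (simp add: lt)
  define M where "M = Moebius_function 0 (h 0)"
  define D where "D = 1 - (cmod (h 0))\<^sup>2"
  have D: "D > 0"
    using lt0 by (simp add: D_def abs_square_less_1)
  have hol': "(M \<circ> h) holomorphic_on \<bbbD>"
    unfolding M_def
    by (rule holomorphic_on_compose_gen[OF hol Moebius_function_holomorphic[OF lt0]])
       (use lt in auto)
  have "cmod (deriv (M \<circ> h) 0) \<le> 1"
  proof (rule Schwarz_Lemma(2)[OF hol', of 0])
    show "cmod ((M \<circ> h) z) < 1" if "cmod z < 1" for z
      using Moebius_function_norm_lt_1[OF lt0 lt] that by (simp add: M_def)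
  qed (simp_all add: M_def Moebius_function_eq_zero)
  also have "deriv (M \<circ> h) 0 = deriv h 0 / of_real D"
  proof -
    have dh: "(h has_field_derivative deriv h 0) (at 0)"
      by (rule holomorphic_derivI[OF hol]) auto
    have nz: "1 - cnj (h 0) * h 0 \<noteq> 0"
      unfolding one_minus_cmod_square using D by (simp add: D_def del: of_real_diff)
    have "(M has_field_derivative 1 / of_real D) (at (h 0))"
      unfolding M_def Moebius_function_def D_def one_minus_cmod_square[symmetric]
      using nz by (auto intro!: derivative_eq_intros)
    from DERIV_chain[OF this dh] show ?thesis
      by (simp add: DERIV_imp_deriv)
  qed
  also have "cmod \<dots> = cmod (deriv h 0) / D"
    using D by (simp add: norm_divide)
  finally show ?thesis
    using D by (simp add: D_def)
qed

lemma times_fps_expansion: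
  assumes "h holomorphic_on \<bbbD>" "\<And>z. z \<in> \<bbbD> \<Longrightarrow> f z = z * h z"
  shows "fps_expansion f 0 = fps_X * fps_expansion h 0"
proof (rule fps_expansion_eqI)
  have "(\<lambda>z. z * h z) has_fps_expansion fps_X * fps_expansion h 0"
    by (intro fps_expansion_intros has_fps_expansion_on_disc assms(1))
  moreover have "\<forall>\<^sub>F z in nhds 0. z * h z = f z"
    by (rule eventually_nhds_0_if_on_disc) (simp add: assms(2))
  ultimately show "f has_fps_expansion fps_X * fps_expansion h 0"
    by (metis has_fps_expansion_cong)
qed

text \<open>By the Schwarz lemma \<open>\<omega> z = z * h z\<close> with \<open>|h| \<le> 1\<close>; the two coefficients of \<open>\<omega>\<close> are
  \<open>h 0\<close> and \<open>h' 0\<close>, to which the Schwarz--Pick inequality applies.\<close>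

lemma schwarz_function_coeffs:
  assumes "schwarz_function \<omega>"
  shows "(taylor_coeff \<omega> 1, taylor_coeff \<omega> 2) \<in> schwarz_coeffs"
proof -
  have hol: "\<omega> holomorphic_on \<bbbD>" and 0: "\<omega> 0 = 0" and lt: "\<And>z. cmod z < 1 \<Longrightarrow> cmod (\<omega> z) < 1"
    using assms by (auto simp: schwarz_function_def image_subset_iff)
  obtain h where h: "h holomorphic_on \<bbbD>" "\<And>z. cmod z < 1 \<Longrightarrow> \<omega> z = z * h z" "deriv \<omega> 0 = h 0"
    using Schwarz3[OF hol 0] by metis
  have le: "cmod (h z) \<le> 1" if "z \<in> \<bbbD>" for z
  proof (cases "z = 0")
    case True
    then show ?thesis
      using Schwarz_Lemma(2)[OF hol 0 lt, of 0] h(3) by simp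
  next
    case False
    then show ?thesis
      using Schwarz_Lemma(1)[OF hol 0 lt, of z] h(2)[of z] that by (simp add: norm_mult)
  qed
  have W: "fps_expansion \<omega> 0 = fps_X * fps_expansion h 0"
    by (rule times_fps_expansion) (use h in auto)
  have "taylor_coeff \<omega> 1 = h 0" "taylor_coeff \<omega> 2 = deriv h 0"
    by (simp_all add: W numeral_2_eq_2 taylor_coeff_0 taylor_coeff_1)
  then show ?thesis
    using Schwarz_Pick_at_0[OF h(1) le] le[of 0] by (simp add: schwarz_coeffs_def)
qed

text \<open>For \<open>|c| < 1\<close> the function \<open>\<omega>(z) = z (c + e z) / (1 + cnj c e z)\<close> with \<open>e = d / (1 - |c|\<^sup>2)\<close> works,
  since \<open>|e| \<le> 1\<close> and a Moebius map of the disc with derivative \<open>1 - |c|\<^sup>2\<close> at \<open>0\<close> is applied to \<open>e z\<close>.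
  For \<open>|c| = 1\<close> the constraint forces \<open>d = 0\<close>, and \<open>\<omega>\<close> is a rotation.\<close>

lemma schwarz_function_exists:
  assumes "(c, d) \<in> schwarz_coeffs"
  obtains \<omega> where "schwarz_function \<omega>" "taylor_coeff \<omega> 1 = c" "taylor_coeff \<omega> 2 = d"
proof -
  obtain h where h: "h holomorphic_on \<bbbD>" "\<And>z. z \<in> \<bbbD> \<Longrightarrow> cmod (h z) \<le> 1" "h 0 = c" "deriv h 0 = d"
  proof (cases "cmod c = 1")
    case True
    then show ?thesis
      using assms by (intro that[of "\<lambda>_. c"]) (auto simp: schwarz_coeffs_def)
  next
    case False
    define D where "D = 1 - (cmod c)\<^sup>2"
    have c: "cmod c < 1" and d: "cmod d \<le> D"
      using False assms by (auto simp: schwarz_coeffs_def D_def)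
    then have D: "D > 0"
      by (simp add: D_def abs_square_less_1)
    define e where "e = d / of_real D"
    have e: "cmod e \<le> 1"
      using d D by (simp add: e_def norm_divide)
    have ez: "cmod (e * z) < 1" if "z \<in> \<bbbD>" for z
      using mult_right_mono[OF e, of "cmod z"] that by (simp add: norm_mult)
    define h where "h = Moebius_function 0 (- c) \<circ> (\<lambda>z. e * z)"
    show ?thesis
    proof (rule that[of h])
      show "h holomorphic_on \<bbbD>"
        unfolding h_def
        by (rule holomorphic_on_compose_gen[OF _ Moebius_function_holomorphic])
           (use c ez in \<open>auto intro!: holomorphic_intros\<close>)
      show "cmod (h z) \<le> 1" if "z \<in> \<bbbD>" for z
        unfolding h_def comp_def
        by (rule less_imp_le[OF Moebius_function_norm_lt_1]) (use c ez that in auto)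
      show "h 0 = c"
        by (simp add: h_def Moebius_function_def)
      have "(h has_field_derivative (1 - cnj c * c) * e) (at 0)"
        unfolding h_def comp_def Moebius_function_def
        by (auto intro!: derivative_eq_intros simp: algebra_simps)
      then have "deriv h 0 = of_real D * e"
        unfolding one_minus_cmod_square D_def by (rule DERIV_imp_deriv)
      then show "deriv h 0 = d"
        using D by (simp add: e_def)
    qed
  qed
  define \<omega> where "\<omega> = (\<lambda>z. z * h z)"
  have W: "fps_expansion \<omega> 0 = fps_X * fps_expansion h 0"
    by (rule times_fps_expansion) (use h in \<open>auto simp: \<omega>_def\<close>)
  show ?thesis
  proof (rule that[of \<omega>])
    have "cmod (z * h z) < 1" if "z \<in> \<bbbD>" for z
      using mult_left_mono[OF h(2)[OF that], of "cmod z"] that by (simp add: norm_mult)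
    then show "schwarz_function \<omega>"
      using h(1) by (auto simp: schwarz_function_def \<omega>_def intro!: holomorphic_intros)
    show "taylor_coeff \<omega> 1 = c" "taylor_coeff \<omega> 2 = d"
      by (simp_all add: W numeral_2_eq_2 taylor_coeff_0 taylor_coeff_1 h)
  qed
qed

lemma compact_schwarz_coeffs: "compact schwarz_coeffs"
proof -
  have "schwarz_coeffs = {p. cmod (fst p) \<le> 1} \<inter> {p. cmod (snd p) \<le> 1 - (cmod (fst p))\<^sup>2}"
    by (auto simp: schwarz_coeffs_def)
  moreover have "closed \<dots>"
    by (intro closed_Int closed_Collect_le continuous_intros)
  ultimately have "closed schwarz_coeffs"
    by simp
  moreover have "schwarz_coeffs \<subseteq> cball 0 1 \<times> cball 0 1"
    using zero_le_power2 by (fastforce simp: schwarz_coeffs_def intro: order_trans[of _ "1 - _"])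
  then have "bounded schwarz_coeffs"
    by (rule bounded_subset[rotated]) (intro bounded_Times bounded_cball)
  ultimately show ?thesis
    by (simp add: compact_eq_bounded_closed)
qed

section \<open>The coefficient region of the convex class\<close>

text \<open>The differential equation is stated without division, which turns it into an identity of
  formal power series whose coefficients of order 1 and 2 determine \<open>a\<^sub>2\<close> and \<open>a\<^sub>3\<close>.\<close>

lemma convex_coeffs:
  assumes f: "f \<in> class_A" and \<Phi>: "\<Phi> holomorphic_on \<bbbD>" "\<Phi> 0 = 1" and \<omega>: "schwarz_function \<omega>"
    and eq: "\<And>z. z \<in> \<bbbD> \<Longrightarrow> z * deriv (deriv f) z = (\<Phi> (\<omega> z) - 1) * deriv f z"
  shows "taylor_coeff f 2 = taylor_coeff \<Phi> 1 * taylor_coeff \<omega> 1 / 2"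
    and "taylor_coeff f 3 = (taylor_coeff \<Phi> 1 * taylor_coeff \<omega> 2
           + (taylor_coeff \<Phi> 2 + (taylor_coeff \<Phi> 1)\<^sup>2) * (taylor_coeff \<omega> 1)\<^sup>2) / 6"
proof -
  define F P W where "F = fps_expansion f 0" and "P = fps_expansion \<Phi> 0" and "W = fps_expansion \<omega> 0"
  have hol: "f holomorphic_on \<bbbD>" "\<omega> holomorphic_on \<bbbD>"
    using f \<omega> by (auto simp: class_A_def schwarz_function_def)
  have F: "f has_fps_expansion F" and P: "\<Phi> has_fps_expansion P" and W: "\<omega> has_fps_expansion W"
    unfolding F_def P_def W_def by (intro has_fps_expansion_on_disc hol \<Phi>)+
  have c: "F $ 0 = 0" "F $ Suc 0 = 1" "P $ 0 = 1" "W $ 0 = 0"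
    using f \<Phi> \<omega> by (auto simp: F_def P_def W_def taylor_coeff_0 taylor_coeff_1 class_A_def schwarz_function_def)
  have "(\<lambda>z. z * deriv (deriv f) z) has_fps_expansion fps_X * fps_deriv (fps_deriv F)"
    by (intro fps_expansion_intros F)
  moreover have "(\<lambda>z. ((\<Phi> \<circ> \<omega>) z - 1) * deriv f z) has_fps_expansion ((P oo W) - 1) * fps_deriv F"
    by (intro fps_expansion_intros F P W c)
  moreover have "\<forall>\<^sub>F z in nhds 0. z * deriv (deriv f) z = ((\<Phi> \<circ> \<omega>) z - 1) * deriv f z"
    by (rule eventually_nhds_0_if_on_disc) (simp add: eq)
  ultimately have E: "fps_X * fps_deriv (fps_deriv F) = ((P oo W) - 1) * fps_deriv F"
    by (rule fps_expansion_unique_eventually)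
  have PW: "(P oo W) $ 0 = 1" "(P oo W) $ Suc 0 = P $ Suc 0 * W $ Suc 0"
    "(P oo W) $ 2 = P $ Suc 0 * W $ 2 + P $ 2 * (W $ Suc 0)\<^sup>2"
    by (simp_all add: fps_compose_nth c numeral_2_eq_2 fps_mult_nth power2_eq_square)
  have E1: "2 * F $ 2 = P $ Suc 0 * W $ Suc 0"
    using arg_cong[OF E, of "\<lambda>G. fps_nth G (Suc 0)"] by (simp add: fps_mult_nth PW c numeral_2_eq_2)
  have E2: "6 * F $ 3 = P $ Suc 0 * W $ Suc 0 * (2 * F $ 2)
      + (P $ Suc 0 * W $ 2 + P $ 2 * (W $ Suc 0)\<^sup>2)"
    using arg_cong[OF E, of "\<lambda>G. fps_nth G 2"] PW(3)
    by (simp add: fps_mult_nth PW c numeral_2_eq_2 numeral_3_eq_3)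
  show "taylor_coeff f 2 = taylor_coeff \<Phi> 1 * taylor_coeff \<omega> 1 / 2"
    using E1 by (simp add: F_def P_def W_def field_simps)
  show "taylor_coeff f 3 = (taylor_coeff \<Phi> 1 * taylor_coeff \<omega> 2
           + (taylor_coeff \<Phi> 2 + (taylor_coeff \<Phi> 1)\<^sup>2) * (taylor_coeff \<omega> 1)\<^sup>2) / 6"
    using E2 unfolding E1 by (simp add: F_def P_def W_def field_simps power2_eq_square)
qed

lemma holomorphic_primitive_on_disc:
  assumes "f holomorphic_on \<bbbD>"
  obtains g where "\<And>z. z \<in> \<bbbD> \<Longrightarrow> (g has_field_derivative f z) (at z)"
  using holomorphic_convex_primitive'[OF convex_ball open_ball assms] by (metis at_within_open open_ball)

text \<open>The function \<open>q = (\<Phi> \<circ> \<omega> - 1) / z\<close> has a removable singularity at \<open>0\<close>, and the equation reads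
  \<open>f'' = q f'\<close>. Two integrations on the disc give \<open>f' = exp (\<integral> q)\<close>, which has no zero, and then \<open>f\<close>.\<close>

lemma ma_minda_convex_exists:
  assumes \<Phi>: "\<Phi> holomorphic_on \<bbbD>" "\<Phi> 0 = 1" and \<omega>: "schwarz_function \<omega>"
  obtains f where "f \<in> ma_minda_convex \<Phi>"
    "\<And>z. z \<in> \<bbbD> \<Longrightarrow> z * deriv (deriv f) z = (\<Phi> (\<omega> z) - 1) * deriv f z"
proof -
  have \<omega>': "\<omega> holomorphic_on \<bbbD>" "\<omega> ` \<bbbD> \<subseteq> \<bbbD>" "\<omega> 0 = 0"
    using \<omega> by (auto simp: schwarz_function_def)
  have hol\<Phi>\<omega>: "(\<lambda>z. \<Phi> (\<omega> z)) holomorphic_on \<bbbD>"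
    using holomorphic_on_compose_gen[OF \<omega>'(1) \<Phi>(1) \<omega>'(2)] by (simp add: comp_def)
  obtain q where q: "q holomorphic_on \<bbbD>" "\<And>z. cmod z < 1 \<Longrightarrow> \<Phi> (\<omega> z) - 1 = z * q z"
    by (rule Schwarz3[of "\<lambda>z. \<Phi> (\<omega> z) - 1" 1])
       (use hol\<Phi>\<omega> \<Phi>(2) \<omega>'(3) in \<open>auto intro!: holomorphic_intros\<close>)
  obtain Q where Q: "\<And>z. z \<in> \<bbbD> \<Longrightarrow> (Q has_field_derivative q z) (at z)"
    using holomorphic_primitive_on_disc[OF q(1)] by blast
  define g where "g = (\<lambda>z. exp (Q z - Q 0))"
  have g': "(g has_field_derivative q z * g z) (at z)" if "z \<in> \<bbbD>" for z
    unfolding g_def by (rule derivative_eq_intros Q that refl | simp)+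
  then have holg: "g holomorphic_on \<bbbD>"
    by (meson holomorphic_on_open open_ball)
  obtain G where G: "\<And>z. z \<in> \<bbbD> \<Longrightarrow> (G has_field_derivative g z) (at z)"
    using holomorphic_primitive_on_disc[OF holg] by blast
  define f where "f = (\<lambda>z. G z - G 0)"
  have f': "(f has_field_derivative g z) (at z)" if "z \<in> \<bbbD>" for z
    unfolding f_def by (rule derivative_eq_intros G that refl | simp)+
  have holf: "f holomorphic_on \<bbbD>"
    using f' by (meson holomorphic_on_open open_ball)
  have df: "deriv f z = g z" if "z \<in> \<bbbD>" for z
    using f'[OF that] by (rule DERIV_imp_deriv)
  have ddf: "deriv (deriv f) z = q z * g z" if "z \<in> \<bbbD>" for z
  proof -
    have "deriv (deriv f) z = deriv g z"
      by (rule complex_derivative_transform_within_open[OF _ holg open_ball that])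
         (auto simp: df holf holomorphic_deriv)
    then show ?thesis
      using DERIV_imp_deriv[OF g'[OF that]] by simp
  qed
  show ?thesis
  proof (rule that[of f])
    show "z * deriv (deriv f) z = (\<Phi> (\<omega> z) - 1) * deriv f z" if "z \<in> \<bbbD>" for z
      using q(2)[of z] that by (simp add: df ddf)
    have nz: "g z \<noteq> 0" for z
      by (simp add: g_def)
    have eq: "1 + z * deriv (deriv f) z / deriv f z = \<Phi> (\<omega> z)" if "z \<in> \<bbbD>" for z
      using q(2)[of z] that nz[of z] by (simp add: df ddf algebra_simps)
    have "(\<lambda>z. 1 + z * deriv (deriv f) z / deriv f z) holomorphic_on \<bbbD>"
      using hol\<Phi>\<omega> by (rule holomorphic_transform) (simp add: eq)
    then have "(\<lambda>z. 1 + z * deriv (deriv f) z / deriv f z) \<prec>\<^sub>D \<Phi>"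
      unfolding subordinate_def using \<Phi> \<omega>' eq by blast
    moreover have "f \<in> class_A"
      using holf df[of 0] by (simp add: class_A_def f_def g_def)
    ultimately show "f \<in> ma_minda_convex \<Phi>"
      by (simp add: ma_minda_convex_def df nz)
  qed
qed

text \<open>The class enters the extremal problems only through this region, which reduces them to a
  finite-dimensional question about \<open>schwarz_coeffs\<close>.\<close>

theorem ma_minda_convex_coeff_region:
  assumes \<Phi>: "\<Phi> holomorphic_on \<bbbD>" "\<Phi> 0 = 1"
  defines "B\<^sub>1 \<equiv> taylor_coeff \<Phi> 1" and "B\<^sub>2 \<equiv> taylor_coeff \<Phi> 2"
  shows "(\<lambda>f. (taylor_coeff f 2, taylor_coeff f 3)) ` ma_minda_convex \<Phi>
       = (\<lambda>(c, d). (B\<^sub>1 * c / 2, (B\<^sub>1 * d + (B\<^sub>2 + B\<^sub>1\<^sup>2) * c\<^sup>2) / 6)) ` schwarz_coeffs"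
    (is "?coeffs ` _ = ?R ` _")
proof (intro equalityI subsetI; elim imageE)
  fix p f assume p: "p = ?coeffs f" and f: "f \<in> ma_minda_convex \<Phi>"
  then obtain \<omega> where \<omega>: "schwarz_function \<omega>"
      "\<And>z. z \<in> \<bbbD> \<Longrightarrow> 1 + z * deriv (deriv f) z / deriv f z = \<Phi> (\<omega> z)"
    unfolding ma_minda_convex_def subordinate_def schwarz_function_def by blast
  have nz: "\<And>z. z \<in> \<bbbD> \<Longrightarrow> deriv f z \<noteq> 0" and fA: "f \<in> class_A"
    using f by (auto simp: ma_minda_convex_def)
  have "z * deriv (deriv f) z = (\<Phi> (\<omega> z) - 1) * deriv f z" if "z \<in> \<bbbD>" for z
    using nz[OF that] by (simp flip: \<omega>(2)[OF that])
  note co = convex_coeffs[OF fA \<Phi> \<omega>(1) this]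
  have "p = ?R (taylor_coeff \<omega> 1, taylor_coeff \<omega> 2)"
    unfolding p B\<^sub>1_def B\<^sub>2_def using co by simp
  then show "p \<in> ?R ` schwarz_coeffs"
    using schwarz_function_coeffs[OF \<omega>(1)] by blast
next
  fix p x assume p: "p = ?R x" and x: "x \<in> schwarz_coeffs"
  obtain c d where cd: "x = (c, d)"
    by fastforce
  obtain \<omega> where \<omega>: "schwarz_function \<omega>" "taylor_coeff \<omega> 1 = c" "taylor_coeff \<omega> 2 = d"
    using schwarz_function_exists x cd by blast
  obtain f where f: "f \<in> ma_minda_convex \<Phi>"
    "\<And>z. z \<in> \<bbbD> \<Longrightarrow> z * deriv (deriv f) z = (\<Phi> (\<omega> z) - 1) * deriv f z"
    using ma_minda_convex_exists[OF \<Phi> \<omega>(1)] by blast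
  have "f \<in> class_A"
    using f(1) by (simp add: ma_minda_convex_def)
  note co = convex_coeffs[OF this \<Phi> \<omega>(1) f(2)]
  have "p = ?coeffs f"
    unfolding p cd B\<^sub>1_def B\<^sub>2_def using co \<omega> by simp
  then show "p \<in> ?coeffs ` ma_minda_convex \<Phi>"
    using f(1) by blast
qed

section \<open>Coefficients of the inverse\<close>

text \<open>The inverse is defined by choice; its properties are available because a holomorphic function
  with nonzero derivative at \<open>0\<close> is locally invertible.\<close>

lemma is_inverse_near_0_inverse_near_0:
  assumes "f \<in> class_A"
  shows "is_inverse_near_0 f (inverse_near_0 f)"
proof -
  have f: "f holomorphic_on \<bbbD>" "f 0 = 0" "deriv f 0 = 1"
    using assms by (auto simp: class_A_def)
  obtain r where r: "r > 0" "ball 0 r \<subseteq> \<bbbD>" "open (f ` ball 0 r)" "inj_on f (ball 0 r)"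
    using has_complex_derivative_locally_invertible[OF f(1), of 0] f(3) by auto
  have holf: "f holomorphic_on ball 0 r"
    using f(1) r(2) by (rule holomorphic_on_subset)
  obtain g where g: "g holomorphic_on f ` ball 0 r" "\<And>z. z \<in> ball 0 r \<Longrightarrow> g (f z) = z"
    using holomorphic_has_inverse[OF holf open_ball r(4)] by metis
  have 0: "0 \<in> f ` ball 0 r"
    using f(2) r(1) by (intro image_eqI[of _ _ 0]) auto
  have "is_inverse_near_0 f g"
    unfolding is_inverse_near_0_def
  proof (intro conjI)
    show "g analytic_on {0}"
      using g(1) r(3) 0 analytic_at by blast
    show "g 0 = 0"
      using g(2)[of 0] f(2) r(1) by simp
    show "\<forall>\<^sub>F z in nhds 0. f (g z) = z"
      using eventually_nhds_in_open[OF r(3) 0] by eventually_elim (use g(2) in auto)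
  qed
  then show ?thesis
    unfolding inverse_near_0_def by (rule someI[of "is_inverse_near_0 f"])
qed

text \<open>The equation \<open>f (g z) = z\<close> near \<open>0\<close> becomes the identity \<open>F oo G = fps_X\<close>, which can be
  solved for the coefficients of \<open>G\<close> one after the other.\<close>

lemma inverse_near_0_coeffs:
  assumes "f \<in> class_A"
  shows "taylor_coeff (inverse_near_0 f) 2 = - taylor_coeff f 2"
    and "taylor_coeff (inverse_near_0 f) 3 = 2 * (taylor_coeff f 2)\<^sup>2 - taylor_coeff f 3"
proof -
  define g where "g = inverse_near_0 f"
  have g: "g analytic_on {0}" "g 0 = 0" "\<forall>\<^sub>F z in nhds 0. f (g z) = z"
    using is_inverse_near_0_inverse_near_0[OF assms] by (auto simp: is_inverse_near_0_def g_def)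
  define F G where "F = fps_expansion f 0" and "G = fps_expansion g 0"
  have F: "f has_fps_expansion F" and G: "g has_fps_expansion G"
    unfolding F_def G_def using assms g(1)
    by (auto simp: class_A_def intro: has_fps_expansion_on_disc analytic_at_imp_has_fps_expansion_0)
  have c: "F $ 0 = 0" "F $ Suc 0 = 1" "G $ 0 = 0"
    using assms g(2) by (auto simp: F_def G_def taylor_coeff_0 taylor_coeff_1 class_A_def)
  have "(f \<circ> g) has_fps_expansion (F oo G)"
    by (intro fps_expansion_intros F G c)
  moreover have "\<forall>\<^sub>F z in nhds 0. (f \<circ> g) z = z"
    using g(3) by simp
  ultimately have E: "(F oo G) = fps_X"
    by (intro fps_expansion_unique_eventually[OF _ has_fps_expansion_fps_X])
  have G1: "G $ Suc 0 = 1"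
    using arg_cong[OF E, of "\<lambda>H. fps_nth H (Suc 0)"] by (simp add: fps_compose_nth c)
  have G2: "G $ 2 = - F $ 2"
    using arg_cong[OF E, of "\<lambda>H. fps_nth H 2"]
    by (simp add: fps_compose_nth c G1 numeral_2_eq_2 fps_mult_nth add_eq_0_iff)
  have "G $ 3 + 2 * F $ 2 * G $ 2 + F $ 3 = 0"
    using arg_cong[OF E, of "\<lambda>H. fps_nth H 3"]
    by (simp add: fps_compose_nth c G1 numeral_2_eq_2 numeral_3_eq_3 fps_mult_nth algebra_simps)
  then have G3: "G $ 3 = 2 * (F $ 2)\<^sup>2 - F $ 3"
    unfolding G2 by (simp add: power2_eq_square algebra_simps add_eq_0_iff)
  show "taylor_coeff (inverse_near_0 f) 2 = - taylor_coeff f 2"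
    "taylor_coeff (inverse_near_0 f) 3 = 2 * (taylor_coeff f 2)\<^sup>2 - taylor_coeff f 3"
    using G2 G3 by (simp_all add: F_def G_def g_def)
qed

section \<open>The two minima\<close>

theorem mainTheorem4:
  fixes \<Phi> :: "complex \<Rightarrow> complex"
  assumes "ma_minda_function \<Phi>"
    and "taylor_coeff \<Phi> 2 = (taylor_coeff \<Phi> 1)\<^sup>2 / 2"
  defines "L \<equiv> \<lambda>f. cmod (taylor_coeff f 3) - cmod (taylor_coeff f 2)"
  shows "\<exists>f\<^sub>1 f\<^sub>2.
           is_arg_min L (\<lambda>f. f \<in> ma_minda_convex \<Phi>) f\<^sub>1 \<and>
           is_arg_min (\<lambda>f. L (inverse_near_0 f)) (\<lambda>f. f \<in> ma_minda_convex \<Phi>) f\<^sub>2 \<and>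
           L f\<^sub>1 = L (inverse_near_0 f\<^sub>2)"
proof -
  define B where "B = taylor_coeff \<Phi> 1"
  \<comment> \<open>\<open>R\<close> sends Schwarz coefficients to \<open>(a\<^sub>2, a\<^sub>3)\<close>; the second entry already uses \<open>B\<^sub>2 = B\<^sub>1\<^sup>2 / 2\<close>.\<close>
  define R where "R = (\<lambda>(c, d). (B * c / 2, (B * c / 2)\<^sup>2 + B * d / 6))"
  define J where "J = (\<lambda>(a\<^sub>2, a\<^sub>3). cmod a\<^sub>3 - cmod a\<^sub>2) \<circ> R"
  have \<Phi>: "\<Phi> holomorphic_on \<bbbD>" "\<Phi> 0 = 1"
    using assms(1) by (auto simp: ma_minda_function_def)
  have "R = (\<lambda>(c, d). (B * c / 2, (B * d + (taylor_coeff \<Phi> 2 + B\<^sup>2) * c\<^sup>2) / 6))"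
    unfolding R_def assms(2) B_def[symmetric] by (auto simp: fun_eq_iff field_simps power2_eq_square)
  then have region: "(\<lambda>f. (taylor_coeff f 2, taylor_coeff f 3)) ` ma_minda_convex \<Phi> = R ` schwarz_coeffs"
    using ma_minda_convex_coeff_region[OF \<Phi>] by (simp add: B_def)
  have L_inverse: "L (inverse_near_0 f) = cmod (2 * (taylor_coeff f 2)\<^sup>2 - taylor_coeff f 3)
      - cmod (taylor_coeff f 2)" if "f \<in> ma_minda_convex \<Phi>" for f
    using that inverse_near_0_coeffs[of f] by (simp add: L_def ma_minda_convex_def)
  \<comment> \<open>The symmetry that exchanges the two functionals.\<close>
  have reflect: "(c, - d) \<in> schwarz_coeffs" if "(c, d) \<in> schwarz_coeffs" for c d
    using that by (simp add: schwarz_coeffs_def)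
  have coords: "\<exists>c d. (c, d) \<in> schwarz_coeffs \<and> L f = J (c, d) \<and> L (inverse_near_0 f) = J (c, - d)"
    if "f \<in> ma_minda_convex \<Phi>" for f
  proof -
    have "(taylor_coeff f 2, taylor_coeff f 3) \<in> R ` schwarz_coeffs"
      using that region by blast
    then obtain c d where cd: "(c, d) \<in> schwarz_coeffs"
        "taylor_coeff f 2 = B * c / 2" "taylor_coeff f 3 = (B * c / 2)\<^sup>2 + B * d / 6"
      by (auto simp: R_def)
    have "L (inverse_near_0 f) = J (c, - d)"
      unfolding L_inverse[OF that] cd(2,3) by (simp add: J_def R_def)
    moreover have "L f = J (c, d)"
      by (simp add: L_def cd(2,3) J_def R_def)
    ultimately show ?thesis
      using cd(1) by blast
  qed
  have realize: "\<exists>f \<in> ma_minda_convex \<Phi>. L f = J (c, d) \<and> L (inverse_near_0 f) = J (c, - d)"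
    if "(c, d) \<in> schwarz_coeffs" for c d
  proof -
    have "R (c, d) \<in> (\<lambda>f. (taylor_coeff f 2, taylor_coeff f 3)) ` ma_minda_convex \<Phi>"
      using that region by blast
    then obtain f where f: "f \<in> ma_minda_convex \<Phi>"
        "taylor_coeff f 2 = B * c / 2" "taylor_coeff f 3 = (B * c / 2)\<^sup>2 + B * d / 6"
      by (auto simp: R_def)
    have "L (inverse_near_0 f) = J (c, - d)"
      unfolding L_inverse[OF f(1)] f(2,3) by (simp add: J_def R_def)
    moreover have "L f = J (c, d)"
      by (simp add: L_def f(2,3) J_def R_def)
    ultimately show ?thesis
      using f(1) by blast
  qed
  \<comment> \<open>A minimum point \<open>(c, d)\<close> of \<open>J\<close> gives \<open>f\<^sub>1\<close>, and its reflection \<open>(c, - d)\<close> gives \<open>f\<^sub>2\<close>.\<close>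
  have "continuous_on schwarz_coeffs J"
    unfolding J_def R_def comp_def case_prod_unfold fst_conv snd_conv by (intro continuous_intros) auto
  moreover have "(0, 0) \<in> schwarz_coeffs"
    by (simp add: schwarz_coeffs_def)
  ultimately obtain c d where cd: "(c, d) \<in> schwarz_coeffs"
      and min: "\<And>x. x \<in> schwarz_coeffs \<Longrightarrow> J (c, d) \<le> J x"
    using continuous_attains_inf[OF compact_schwarz_coeffs, of J] by (metis empty_iff surj_pair)
  obtain f\<^sub>1 where f1: "f\<^sub>1 \<in> ma_minda_convex \<Phi>" "L f\<^sub>1 = J (c, d)"
    using realize[OF cd] by blast
  obtain f\<^sub>2 where f2: "f\<^sub>2 \<in> ma_minda_convex \<Phi>" "L (inverse_near_0 f\<^sub>2) = J (c, d)"
    using realize[OF reflect[OF cd]] by auto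
  have "J (c, d) \<le> L f" "J (c, d) \<le> L (inverse_near_0 f)" if "f \<in> ma_minda_convex \<Phi>" for f
    using coords[OF that] min reflect by metis+
  then have "is_arg_min L (\<lambda>f. f \<in> ma_minda_convex \<Phi>) f\<^sub>1"
    and "is_arg_min (\<lambda>f. L (inverse_near_0 f)) (\<lambda>f. f \<in> ma_minda_convex \<Phi>) f\<^sub>2"
    using f1 f2 by (simp_all add: is_arg_min_linorder)
  then show ?thesis
    unfolding f1(2)[symmetric] f2(2)[symmetric] using f1(2) f2(2) by metis
qed

end
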